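(* Let $w_1,w_2,w_3$ be any positive integers. Then for every integer $n\ge 0$ and all $y_1,y_2,y_3\in\mathbb{Z}_p$, the following six expressions are equal: \begin{align*} &\sum_{k+l+m=n}\binom{n}{k,l,m}E_{k,\chi}(w_1y_1)E_{l,\chi}(w_2y_2)E_{m,\chi}(w_3y_3)\,w_{1}^{l+m}w_{2}^{k+m}w_{3}^{k+l}\\ =&\sum_{k+l+m=n}\binom{n}{k,l,m}E_{k,\chi}(w_1y_1)E_{l,\chi}(w_3y_2)E_{m,\chi}(w_2y_3)\,w_{1}^{l+m}w_{3}^{k+m}w_{2}^{k+l}\\ =&\sum_{k+l+m=n}\binom{n}{k,l,m}E_{k,\chi}(w_2y_1)E_{l,\chi}(w_1y_2)E_{m,\chi}(w_3y_3)\,w_{2}^{l+m}w_{1}^{k+m}w_{3}^{k+l}\\ =&\sum_{k+l+m=n}\binom{n}{k,l,m}E_{k,\chi}(w_2y_1)E_{l,\chi}(w_3y_2)E_{m,\chi}(w_1y_3)\,w_{2}^{l+m}w_{3}^{k+m}w_{1}^{k+l}\\ =&\sum_{k+l+m=n}\binom{n}{k,l,m}E_{k,\chi}(w_3y_1)E_{l,\chi}(w_1y_2)E_{m,\chi}(w_2y_3)\,w_{3}^{l+m}w_{1}^{k+m}w_{2}^{k+l}\\ =&\sum_{k+l+m=n}\binom{n}{k,l,m}E_{k,\chi}(w_3y_1)E_{l,\chi}(w_2y_2)E_{m,\chi}(w_1y_3)\,w_{3}^{l+m}w_{2}^{k+m}w_{1}^{k+l}. \end{align*} Here each sum is over all nonnegative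 integers $k,l,m$ with $k+l+m=n$.
   Context: $p$ is a fixed odd prime, $\mathbb{Z}_p$ is the ring of $p$-adic integers, and $\mathbb{C}_p$ is the completion of an algebraic closure of $\mathbb{Q}_p$. $d$ is a fixed odd positive integer and $\chi$ is a (primitive) Dirichlet character of conductor $d$, with values in $\overline{\mathbb{Q}}$, regarded as $\mathbb{C}_p$-valued through a fixed embedding $\overline{\mathbb{Q}}\to\mathbb{C}_p$; as usual $\chi(a)=0$ when $\gcd(a,d)>1$ (and $\chi\equiv 1$ if $d=1$). The generalized Euler polynomials $E_{n,\chi}(x)$ attached to $\chi$ are the polynomials in $x$ defined by $$\frac{2e^{xt}}{e^{dt}+1}\sum_{a=0}^{d-1}(-1)^a\chi(a)e^{at}=\sum_{n=0}^{\infty}E_{n,\chi}(x)\frac{t^n}{n!}.$$ The multinomial coefficient is $\binom{n}{k,l,m}=\frac{n!}{k!\,l!\,m!}$. *)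

theory Defs
  imports
    "HOL-Analysis.Analysis"
    "HOL-Computational_Algebra.Computational_Algebra"
    "HOL-Number_Theory.Cong"
begin

unbundle no vec_syntax
unbundle fps_syntax

(* In C_p, the completion of the rationals with respect to the p-adic absolute value. *)
definition padic_rationals :: "'a :: {field_char_0, topological_space} set" where
  "padic_rationals = closure \<rat>"

definition padic_integers ::
    "('a :: {field_char_0, topological_space} \<Rightarrow> real) \<Rightarrow> 'a set" where
  "padic_integers padic_abs = {x \<in> padic_rationals. padic_abs x \<le> 1}"

definition algebraic_over :: "'a :: field set \<Rightarrow> 'a set" where
  "algebraic_over K = {x. \<exists>f. f \<noteq> 0 \<and> (\<forall>i. coeff f i \<in> K) \<and> poly f x = 0}"

(* The field C_p, given by its defining property: a complete field whose metric comes from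
   an absolute value extending the p-adic one, and in which an algebraic closure of Q_p
   is dense.  Completeness is part of the sort.  A multiplicative ultrametric absolute value
   with |p| = 1/p restricts to the p-adic absolute value on the rationals, so the closure of
   the rationals is Q_p.  These conditions determine the field up to isometric isomorphism. *)
locale padic_complex_field =
  fixes p :: nat
    and padic_abs :: "'a :: {field_char_0, complete_space} \<Rightarrow> real"
  assumes prime_p: "prime p"
    and dist_eq: "dist x y = padic_abs (x - y)"
    and abs_mult: "padic_abs (x * y) = padic_abs x * padic_abs y"
    and abs_ultrametric: "padic_abs (x + y) \<le> max (padic_abs x) (padic_abs y)"
    and abs_p: "padic_abs (of_nat p) = 1 / real p"
    and alg_closed:
      "\<lbrakk>\<forall>i. coeff (f :: 'a poly) i \<in> algebraic_over padic_rationals; degree f > 0\<rbrakk>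
         \<Longrightarrow> \<exists>x \<in> algebraic_over padic_rationals. poly f x = 0"
    and dense: "closure (algebraic_over (padic_rationals :: 'a set)) = UNIV"

(* The algebraic numbers inside the complex numbers serve as the algebraic closure of Q;
   values of \<iota> elsewhere are irrelevant.  Injectivity is automatic for a unital ring
   homomorphism of fields. *)
definition Qbar_embedding :: "(complex \<Rightarrow> 'a :: field_char_0) \<Rightarrow> bool" where
  "Qbar_embedding \<iota> \<longleftrightarrow>
     \<iota> 1 = 1 \<and>
     (\<forall>x y. algebraic x \<longrightarrow> algebraic y \<longrightarrow>
        \<iota> (x + y) = \<iota> x + \<iota> y \<and> \<iota> (x * y) = \<iota> x * \<iota> y)"

definition dirichlet_character :: "nat \<Rightarrow> (int \<Rightarrow> complex) \<Rightarrow> bool" where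
  "dirichlet_character d \<chi> \<longleftrightarrow>
     d > 0 \<and>
     (\<forall>a b. \<chi> (a * b) = \<chi> a * \<chi> b) \<and>
     (\<forall>a b. [a = b] (mod int d) \<longrightarrow> \<chi> a = \<chi> b) \<and>
     (\<forall>a. \<chi> a = 0 \<longleftrightarrow> \<not> coprime a (int d))"

(* A Dirichlet character is usually taken with values in the algebraic numbers; for a complex-valued
   Dirichlet character this is automatic. *)
lemma dirichlet_character_algebraic:
  assumes \<chi>: "dirichlet_character d \<chi>"
  shows "algebraic (\<chi> a)"
proof -
  have d: "d > 0" and mult: "\<And>x y. \<chi> (x * y) = \<chi> x * \<chi> y"
    and per: "\<And>x y. [x = y] (mod int d) \<Longrightarrow> \<chi> x = \<chi> y"
    and zero: "\<And>x. \<chi> x = 0 \<longleftrightarrow> \<not> coprime x (int d)"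
    using \<chi> unfolding dirichlet_character_def by blast+
  have "\<chi> 1 = 1" using mult[of 1 1] zero[of 1] by simp
  then have pow: "\<chi> (a ^ n) = \<chi> a ^ n" for n
    by (induction n) (simp_all add: mult)
  have "\<chi> x \<in> \<chi> ` {0..<int d}" for x
    using per[of x "x mod int d"] d by (intro image_eqI[of _ _ "x mod int d"]) (auto simp: cong_def)
  then have "range (\<lambda>n. \<chi> a ^ n) \<subseteq> \<chi> ` {0..<int d}"
    by (auto simp flip: pow)
  then have "finite (range (\<lambda>n. \<chi> a ^ n))"
    by (rule finite_subset) simp
  then have "\<not> inj (\<lambda>n. \<chi> a ^ n)"
    using finite_imageD infinite_UNIV_nat by blast
  then obtain m n where mn: "m \<noteq> n" "\<chi> a ^ m = \<chi> a ^ n"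
    by (auto simp: inj_on_def)
  show ?thesis
  proof (rule algebraicI)
    show "coeff (monom 1 m - monom 1 n) i \<in> \<int>" for i by simp
    have "coeff (monom 1 m - monom 1 n) m = (1 :: complex)"
      using \<open>m \<noteq> n\<close> by (simp only: coeff_diff coeff_monom) simp
    then show "monom 1 m - monom 1 n \<noteq> (0 :: complex poly)" by (metis coeff_0 zero_neq_one)
    show "poly (monom 1 m - monom 1 n) (\<chi> a) = 0" using mn by (simp add: poly_monom)
  qed
qed

(* The least modulus e dividing d such that \<chi> is induced from a character modulo e. *)
definition conductor :: "nat \<Rightarrow> (int \<Rightarrow> complex) \<Rightarrow> nat" where
  "conductor d \<chi> =
     (LEAST e. e dvd d \<and> (\<forall>a. coprime a (int d) \<and> [a = 1] (mod int e) \<longrightarrow> \<chi> a = 1))"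

definition primitive_dirichlet_character :: "nat \<Rightarrow> (int \<Rightarrow> complex) \<Rightarrow> bool" where
  "primitive_dirichlet_character d \<chi> \<longleftrightarrow> dirichlet_character d \<chi> \<and> conductor d \<chi> = d"

definition const_poly_fps :: "'a :: zero fps \<Rightarrow> 'a poly fps" where
  "const_poly_fps f = Abs_fps (\<lambda>n. [:f $ n:])"

(* The power series e^{xt} in t, with x the indeterminate of the coefficient ring. *)
definition exp_xt :: "'a :: field_char_0 poly fps" where
  "exp_xt = Abs_fps (\<lambda>n. monom (1 / fact n) n)"

(* 2 e^{xt} / (e^{dt} + 1) * sum_{a<d} (-1)^a \<chi>(a) e^{at} as a power series in t over K[x];
   the x-free factor is formed over the field K, where division of power series is available. *)
definition gen_euler_gf :: "nat \<Rightarrow> (int \<Rightarrow> 'a :: field_char_0) \<Rightarrow> 'a poly fps" where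
  "gen_euler_gf d \<chi> =
     exp_xt * const_poly_fps
       (2 / (fps_exp (of_nat d) + 1) *
        (\<Sum>a<d. fps_const ((-1) ^ a * \<chi> (int a)) * fps_exp (of_nat a)))"

definition gen_euler_poly :: "nat \<Rightarrow> (int \<Rightarrow> 'a :: field_char_0) \<Rightarrow> nat \<Rightarrow> 'a poly" where
  "gen_euler_poly d \<chi> n = smult (fact n) (gen_euler_gf d \<chi> $ n)"

lemma const_poly_fps_mult:
  fixes f g :: "'a :: comm_ring_1 fps"
  shows "const_poly_fps (f * g) = const_poly_fps f * const_poly_fps g"
proof -
  have sum_const: "[:\<Sum>i\<in>A. h i:] = (\<Sum>i\<in>A. [:h i:])" for A and h :: "nat \<Rightarrow> 'a"
  proof (induction A rule: infinite_finite_induct)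
    case (insert x F)
    have "[:h x + sum h F:] = [:h x:] + [:sum h F:]" by simp
    also have "\<dots> = (\<Sum>i\<in>insert x F. [:h i:])"
      unfolding insert.IH by (rule sum.insert[OF insert.hyps, symmetric])
    finally show ?case by (subst sum.insert[OF insert.hyps])
  qed simp_all
  show ?thesis
    by (simp add: fps_eq_iff const_poly_fps_def fps_mult_nth sum_const mult_ac)
qed

(* The defining identity of the polynomials, with denominators cleared. *)
lemma gen_euler_poly_gf:
  fixes \<chi> :: "int \<Rightarrow> 'a :: field_char_0"
  shows "Abs_fps (\<lambda>n. smult (1 / fact n) (gen_euler_poly d \<chi> n)) *
           const_poly_fps (fps_exp (of_nat d) + 1) =
         exp_xt * const_poly_fps
           (2 * (\<Sum>a<d. fps_const ((-1) ^ a * \<chi> (int a)) * fps_exp (of_nat a)))"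
proof -
  let ?D = "fps_exp (of_nat d) + 1 :: 'a fps"
  let ?S = "(\<Sum>a<d. fps_const ((-1) ^ a * \<chi> (int a)) * fps_exp (of_nat a)) :: 'a fps"
  have "?D $ 0 \<noteq> 0" by simp
  then have D: "2 / ?D * ?D = 2"
    by (simp add: fps_divide_unit mult.assoc inverse_mult_eq_1)
  have "2 / ?D * ?S * ?D = 2 / ?D * ?D * ?S"
    by (simp only: mult_ac)
  then have eq: "2 / ?D * ?S * ?D = 2 * ?S"
    by (simp only: D)
  have "Abs_fps (\<lambda>n. smult (1 / fact n) (gen_euler_poly d \<chi> n)) = gen_euler_gf d \<chi>"
    by (simp add: fps_eq_iff gen_euler_poly_def)
  then show ?thesis
    by (simp only: gen_euler_gf_def mult.assoc eq[unfolded mult.assoc] flip: const_poly_fps_mult)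
qed

(* The multinomial coefficient n! / (k! l! m!) of k + l + m = n, as a field element. *)
definition trinomial :: "nat \<Rightarrow> nat \<Rightarrow> nat \<Rightarrow> nat \<Rightarrow> 'a :: field_char_0" where
  "trinomial n k l m = fact n / (fact k * fact l * fact m)"

definition euler_triple_sum ::
    "nat \<Rightarrow> (int \<Rightarrow> 'a :: field_char_0) \<Rightarrow> nat \<Rightarrow> 'a \<Rightarrow> 'a \<Rightarrow> 'a \<Rightarrow> nat \<Rightarrow> nat \<Rightarrow> nat \<Rightarrow> 'a"
  where
  "euler_triple_sum d \<chi> n y1 y2 y3 u v w =
     (\<Sum>(k, l, m) \<in> {(k, l, m). k + l + m = n}.
        trinomial n k l m *
        poly (gen_euler_poly d \<chi> k) (of_nat u * y1) *
        poly (gen_euler_poly d \<chi> l) (of_nat v * y2) *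
        poly (gen_euler_poly d \<chi> m) (of_nat w * y3) *
        of_nat u ^ (l + m) * of_nat v ^ (k + m) * of_nat w ^ (k + l))"

end

(* Put G(t) = 2 / (e^{dt} + 1) * sum_{a<d} (-1)^a \<chi>(a) e^{at}.  The exponential generating function
   of E_{k,\<chi>}(x) is e^{xt} G(t), and u^{l+m} v^{k+m} w^{k+l} = (vw)^k (uw)^l (uv)^m, so the triple
   sum is n! times the coefficient of t^n in e^{uvw(y1+y2+y3)t} G(vwt) G(uwt) G(uvt), which is
   symmetric in u, v, w. *)
theory Submission
  imports Defs
begin

lemma fps_mult3_nth:
  fixes f g h :: "'a :: comm_ring_1 fps"
  shows "(f * g * h) $ n = (\<Sum>(k, l, m) \<in> {(k, l, m). k + l + m = n}. f $ k * g $ l * h $ m)"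
proof -
  have "(f * g * h) $ n = (\<Sum>i\<in>{0..n}. \<Sum>j\<in>{0..i}. f $ j * g $ (i - j) * h $ (n - i))"
    by (simp add: fps_mult_nth sum_distrib_right)
  also have "\<dots> = (\<Sum>(i, j) \<in> (SIGMA i:{0..n}. {0..i}). f $ j * g $ (i - j) * h $ (n - i))"
    by (simp add: sum.Sigma)
  also have "\<dots> = (\<Sum>(k, l, m) \<in> {(k, l, m). k + l + m = n}. f $ k * g $ l * h $ m)"
    \<comment> \<open>The nested Cauchy product has outer index \<open>i\<close> = k + l and inner
      index \<open>j\<close> = k.\<close>
    by (rule sum.reindex_bij_witness
          [where i = "\<lambda>(k, l, m). (k + l, k)" and j = "\<lambda>(i, j). (j, i - j, n - i)"]) auto
  finally show ?thesis .
qed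

text \<open>The series G(t), kept over the field so that, unlike its image in
  \<open>gen_euler_gf\<close>, it can be multiplied by \<open>fps_exp x\<close> for a field element
  x.\<close>

definition euler_factor :: "nat \<Rightarrow> (int \<Rightarrow> 'a :: field_char_0) \<Rightarrow> 'a fps" where
  "euler_factor d \<chi> =
     2 / (fps_exp (of_nat d) + 1) *
       (\<Sum>a<d. fps_const ((-1) ^ a * \<chi> (int a)) * fps_exp (of_nat a))"

text \<open>Evaluation at x, applied to each coefficient, turns \<open>exp_xt\<close> into
  \<open>fps_exp x\<close> and undoes \<open>const_poly_fps\<close>.\<close>

lemma poly_gen_euler_poly:
  "poly (gen_euler_poly d \<chi> n) x = fact n * (fps_exp x * euler_factor d \<chi>) $ n"
  unfolding gen_euler_poly_def gen_euler_gf_def euler_factor_def[symmetric]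
  by (simp add: exp_xt_def const_poly_fps_def fps_mult_nth poly_sum poly_monom mult_ac)

text \<open>The substitution of c t for t is multiplicative and scales the n-th coefficient by
  \<open>c ^ n\<close>. It serves to absorb the weights of the triple sum into the series.\<close>

lemma fps_exp_mult_compose_linear_nth:
  fixes f :: "'a :: field_char_0 fps"
  shows "(fps_exp (x * c) * (f oo (fps_const c * fps_X))) $ n = c ^ n * (fps_exp x * f) $ n"
proof -
  have "(fps_exp x * f) oo (fps_const c * fps_X)
      = fps_exp (x * c) * (f oo (fps_const c * fps_X))"
    by (simp add: fps_compose_mult_distrib fps_exp_compose_linear mult.commute[of x])
  then show ?thesis
    by (metis fps_compose_linear fps_nth_Abs_fps)
qed

lemma euler_triple_sum_eq_nth:
  fixes d :: nat and \<chi> :: "int \<Rightarrow> 'a :: field_char_0"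
  defines "G \<equiv> \<lambda>c. euler_factor d \<chi> oo (fps_const c * fps_X)"
  shows "euler_triple_sum d \<chi> n y1 y2 y3 u v w =
    fact n * (fps_exp (of_nat u * of_nat v * of_nat w * (y1 + y2 + y3)) *
      (G (of_nat v * of_nat w) * G (of_nat u * of_nat w) * G (of_nat u * of_nat v))) $ n"
proof -
  let ?U = "of_nat u :: 'a" and ?V = "of_nat v :: 'a" and ?W = "of_nat w :: 'a"
  let ?F = "\<lambda>x c. fps_exp (x * c) * G c"
  have "euler_triple_sum d \<chi> n y1 y2 y3 u v w =
     (\<Sum>(k, l, m) \<in> {(k, l, m). k + l + m = n}.
        fact n * (?F (?U * y1) (?V * ?W) $ k * ?F (?V * y2) (?U * ?W) $ l *
                  ?F (?W * y3) (?U * ?V) $ m))"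
    unfolding euler_triple_sum_def G_def fps_exp_mult_compose_linear_nth
    \<comment> \<open>The factorials in the denominator of \<open>trinomial\<close> cancel those
      from \<open>poly_gen_euler_poly\<close>; the scalings c = vw, uw, uv supply the powers of u,
      v, w.\<close>
    by (intro sum.cong)
      (auto simp: trinomial_def poly_gen_euler_poly power_add power_mult_distrib)
  also have "\<dots> = fact n * (?F (?U * y1) (?V * ?W) * ?F (?V * y2) (?U * ?W) *
                  ?F (?W * y3) (?U * ?V)) $ n"
    unfolding fps_mult3_nth by (simp add: sum_distrib_left case_prod_unfold)
  also have "?F (?U * y1) (?V * ?W) * ?F (?V * y2) (?U * ?W) * ?F (?W * y3) (?U * ?V) =
      (fps_exp (?U * y1 * (?V * ?W)) * fps_exp (?V * y2 * (?U * ?W)) *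
        fps_exp (?W * y3 * (?U * ?V))) *
      (G (?V * ?W) * G (?U * ?W) * G (?U * ?V))"
    by (simp only: mult_ac)
  \<comment> \<open>Each exponent carries the full product uvw, so y1, y2, y3 enter only through
    their sum and lose their link to a particular weight.\<close>
  also have "fps_exp (?U * y1 * (?V * ?W)) * fps_exp (?V * y2 * (?U * ?W)) *
        fps_exp (?W * y3 * (?U * ?V)) = fps_exp (?U * ?V * ?W * (y1 + y2 + y3))"
    by (simp add: fps_exp_add_mult[symmetric] algebra_simps)
  finally show ?thesis .
qed

text \<open>Swapping u and v exchanges G(vwt) with G(uwt) and fixes G(uvt) and the exponential
  factor.\<close>

lemma euler_triple_sum_commute12:
  "euler_triple_sum d \<chi> n y1 y2 y3 u v w = euler_triple_sum d \<chi> n y1 y2 y3 v u w"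
  by (simp add: euler_triple_sum_eq_nth mult_ac)

lemma euler_triple_sum_commute23:
  "euler_triple_sum d \<chi> n y1 y2 y3 u v w = euler_triple_sum d \<chi> n y1 y2 y3 u w v"
  by (simp add: euler_triple_sum_eq_nth mult_ac)

theorem theorem4p1:
  fixes p d w1 w2 w3 n :: nat
    and padic_abs :: "'a :: {field_char_0, complete_space} \<Rightarrow> real"
    and \<iota> :: "complex \<Rightarrow> 'a"
    and \<chi> :: "int \<Rightarrow> complex"
    and y1 y2 y3 :: 'a
  assumes "padic_complex_field p padic_abs"
    and "odd p"
    and "odd d"
    and "primitive_dirichlet_character d \<chi>"
    and "Qbar_embedding \<iota>"
    and "w1 > 0" and "w2 > 0" and "w3 > 0"
    and "y1 \<in> padic_integers padic_abs"
    and "y2 \<in> padic_integers padic_abs"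
    and "y3 \<in> padic_integers padic_abs"
  shows "let S = euler_triple_sum d (\<iota> \<circ> \<chi>) n y1 y2 y3 in
         S w1 w2 w3 = S w1 w3 w2 \<and>
         S w1 w3 w2 = S w2 w1 w3 \<and>
         S w2 w1 w3 = S w2 w3 w1 \<and>
         S w2 w3 w1 = S w3 w1 w2 \<and>
         S w3 w1 w2 = S w3 w2 w1"
  unfolding Let_def
  \<comment> \<open>The two adjacent transpositions generate all permutations of the three
    weights.\<close>
  by (metis euler_triple_sum_commute12 euler_triple_sum_commute23)

end
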